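(* Let $\{\mathcal{W}_i\}_{i=1}^N$ be a fusion frame for $\mathbb{R}^M$ with bounds $0<A\le B<\infty$, where $\dim \mathcal{W}_i=m_i$ and $\mathbf{P}_i$ is the orthogonal projection onto $\mathcal{W}_i$. Let $\mathbf{x}$ be a zero-mean random vector in $\mathbb{R}^M$ with nonsingular covariance matrix $\mathbf{R}_{xx}=E[\mathbf{x}\mathbf{x}^T]$ with eigenvalues $0<\lambda_1\le\cdots\le\lambda_M$, and let $\mathbf{z}_i=\mathbf{P}_i\mathbf{x}+\mathbf{n}_i$, $i=1,\dots,N$, be its noisy fusion frame measurements, where the noise vectors $\mathbf{n}_i$ are mutually uncorrelated, uncorrelated with $\mathbf{x}$, and white with $E[\mathbf{n}_i\mathbf{n}_i^T]=\sigma_n^2\mathbf{I}$, $\sigma_n^2>0$. Let $MSE$ be the mean-squared error of the linear minimum mean-squared error estimator of $\mathbf{x}$ from $\mathbf{z}=(\mathbf{z}_1^T,\dots,\mathbf{z}_N^T)^T$. Then $$\sum_{i=1}^M\frac{1}{\frac{1}{\lambda_i}+\frac{B}{\sigma_n^2}}\ \le\ MSE\ \le\ \sum_{i=1}^M\frac{1}{\frac{1}{\lambda_i}+\frac{A}{\sigma_n^2}} .$$ The lower bound is achieved when the fusion frame is tight, i.e. when $A=B$ and $\sum_{\ell=1}^N\mathbf{P}_\ell=A\mathbf{I}$; in that case $A=\frac1M\sum_{\ell=1}^N m_\ell$ and $$MSE=\sum_{i=1}^M\frac{\sigma_n^2\lambda_i}{\sigma_n^2+\frac{\lambda_i}{M}\sum_{\ell=1}^N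 m_\ell}.$$
   Context: A fusion frame for $\mathbb{R}^M$ with bounds $0<A\le B<\infty$ is a finite collection of subspaces $\{\mathcal{W}_i\}_{i=1}^N$ of $\mathbb{R}^M$ whose orthogonal projections $\mathbf{P}_i$ ($M\times M$ matrices) satisfy $A\,\mathbf{I}\le\sum_{i=1}^N\mathbf{P}_i\le B\,\mathbf{I}$. It is tight if the bounds can be chosen equal, i.e. $\sum_{i=1}^N\mathbf{P}_i=A\,\mathbf{I}$. The linear minimum mean-squared error (LMMSE) estimator of $\mathbf{x}$ from $\mathbf{z}\in\mathbb{R}^{NM}$ is $\hat{\mathbf{x}}=\mathbf{F}\mathbf{z}$ with $\mathbf{F}=\mathbf{R}_{xz}\mathbf{R}_{zz}^{-1}$, where $\mathbf{R}_{xz}=E[\mathbf{x}\mathbf{z}^T]$ and $\mathbf{R}_{zz}=E[\mathbf{z}\mathbf{z}^T]$. Its mean-squared error is $MSE=\mathrm{tr}\,E[(\mathbf{x}-\mathbf{F}\mathbf{z})(\mathbf{x}-\mathbf{F}\mathbf{z})^T]$. *)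

theory Defs
  imports "HOL-Probability.Probability" "HOL-Computational_Algebra.Polynomial"
begin

definition orth_proj :: "(real ^ 'm) set \<Rightarrow> real ^ 'm \<Rightarrow> real ^ 'm" where
  "orth_proj W v = (THE w. w \<in> W \<and> (\<forall>u\<in>W. orthogonal (v - w) u))"

definition proj_matrix :: "(real ^ 'm) set \<Rightarrow> real ^ 'm ^ 'm" where
  "proj_matrix W = matrix (orth_proj W)"

definition pos_semidef :: "real ^ 'm ^ 'm \<Rightarrow> bool" where
  "pos_semidef A \<longleftrightarrow> transpose A = A \<and> (\<forall>v. 0 \<le> v \<bullet> (A *v v))"

definition loewner_le :: "real ^ 'm ^ 'm \<Rightarrow> real ^ 'm ^ 'm \<Rightarrow> bool" where
  "loewner_le A B \<longleftrightarrow> pos_semidef (B - A)"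

definition fusion_frame :: "real \<Rightarrow> real \<Rightarrow> ('n::finite \<Rightarrow> (real ^ 'm) set) \<Rightarrow> bool" where
  "fusion_frame A B W \<longleftrightarrow>
     0 < A \<and> A \<le> B \<and> (\<forall>i. subspace (W i)) \<and>
     loewner_le (A *\<^sub>R mat 1) (\<Sum>i\<in>UNIV. proj_matrix (W i)) \<and>
     loewner_le (\<Sum>i\<in>UNIV. proj_matrix (W i)) (B *\<^sub>R mat 1)"

definition charpoly :: "real ^ 'm ^ 'm \<Rightarrow> real poly" where
  "charpoly A = det (\<chi> i j. (if i = j then [:0, 1:] else 0) - [:A $ i $ j:])"

text \<open>The eigenvalues of \<open>A\<close>, repeated according to algebraic multiplicity,
  are \<open>l 1 \<le> \<dots> \<le> l M\<close>, where \<open>M\<close> is the size of \<open>A\<close>.\<close>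

definition sorted_eigenvalues :: "real ^ 'm ^ 'm \<Rightarrow> (nat \<Rightarrow> real) \<Rightarrow> bool" where
  "sorted_eigenvalues A l \<longleftrightarrow>
     mono_on {1..CARD('m)} l \<and> charpoly A = (\<Prod>i=1..CARD('m). [:- l i, 1:])"

text \<open>Finite second moments, so that the matrices \<open>E[u v\<^sup>T]\<close> below exist.\<close>

definition square_integrable_rv :: "'w measure \<Rightarrow> ('w \<Rightarrow> real ^ 'm) \<Rightarrow> bool" where
  "square_integrable_rv \<Omega> u \<longleftrightarrow>
     u \<in> borel_measurable \<Omega> \<and> integrable \<Omega> (\<lambda>\<omega>. (norm (u \<omega>))\<^sup>2)"

text \<open>The matrix \<open>E[u v\<^sup>T]\<close>, without centring.\<close>

definition corr_matrix ::
  "'w measure \<Rightarrow> ('w \<Rightarrow> real ^ 'k) \<Rightarrow> ('w \<Rightarrow> real ^ 'm) \<Rightarrow> real ^ 'm ^ 'k" where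
  "corr_matrix \<Omega> u v = (\<chi> i j. integral\<^sup>L \<Omega> (\<lambda>\<omega>. u \<omega> $ i * v \<omega> $ j))"

text \<open>For vectors with mean zero (at least one of the two) this is vanishing covariance.
  For noise with nonzero mean it is the condition on \<open>E[u v\<^sup>T]\<close>, not on the covariance,
  in line with the uncentred second-moment matrices used throughout.\<close>

definition uncorrelated ::
  "'w measure \<Rightarrow> ('w \<Rightarrow> real ^ 'k) \<Rightarrow> ('w \<Rightarrow> real ^ 'm) \<Rightarrow> bool" where
  "uncorrelated \<Omega> u v \<longleftrightarrow> corr_matrix \<Omega> u v = 0"

text \<open>\<open>(z\<^sub>1\<^sup>T, \<dots>, z\<^sub>N\<^sup>T)\<^sup>T\<close>, with block index first.\<close>

definition stack :: "('n::finite \<Rightarrow> real ^ 'm) \<Rightarrow> real ^ ('n \<times> 'm)" where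
  "stack z = (\<chi> k. z (fst k) $ snd k)"

definition lmmse_matrix ::
  "'w measure \<Rightarrow> ('w \<Rightarrow> real ^ 'm) \<Rightarrow> ('w \<Rightarrow> real ^ 'k) \<Rightarrow> real ^ 'k ^ 'm" where
  "lmmse_matrix \<Omega> x z = corr_matrix \<Omega> x z ** matrix_inv (corr_matrix \<Omega> z z)"

definition lmmse_error ::
  "'w measure \<Rightarrow> ('w \<Rightarrow> real ^ 'm) \<Rightarrow> ('w \<Rightarrow> real ^ 'k) \<Rightarrow> real" where
  "lmmse_error \<Omega> x z =
     (let e = (\<lambda>\<omega>. x \<omega> - lmmse_matrix \<Omega> x z *v z \<omega>) in trace (corr_matrix \<Omega> e e))"

end

theory Submission
  imports Defs
begin

text \<open>
  Write \<open>R = E[x x\<^sup>T]\<close>, \<open>S = \<Sum>\<^sub>i P\<^sub>i\<close> and \<open>s = \<sigma>\<^sup>2\<close>. Stacking the measurements gives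
  \<open>z = H x + n\<close> with white noise \<open>n\<close>, where \<open>H\<close> consists of the projections one above the other;
  since each \<open>P\<^sub>i\<close> is symmetric and idempotent, \<open>H\<^sup>T H = S\<close>. The normal equation of the
  estimator then shows that the mean-squared error is the trace of the inverse of
  \<open>Y = R\<^sup>-\<^sup>1 + S/s\<close> (\<open>lmmse_error_eq_trace\<close>, \<open>linear_model_lmmse_error\<close>).

  The frame bounds sandwich \<open>Y\<close> between \<open>R\<^sup>-\<^sup>1 + (A/s) I\<close> and \<open>R\<^sup>-\<^sup>1 + (B/s) I\<close> in the Loewner
  order. Both of these are diagonal in an orthonormal eigenbasis of \<open>R\<close>, with eigenvalues
  \<open>1/\<mu>\<^sub>k + A/s\<close> and \<open>1/\<mu>\<^sub>k + B/s\<close>. Inversion reverses the Loewner order; only its effect on the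
  trace against a diagonal matrix is needed, and this has a direct proof by evaluating quadratic
  forms (\<open>trace_inverse_le\<close>, \<open>trace_inverse_ge\<close>).

  The eigenbasis comes from the spectral theorem (\<open>symmetric_matrix_eigenbasis\<close>). The characteristic
  polynomial identifies its eigenvalues \<open>\<mu>\<^sub>k\<close> with the numbers \<open>l i\<close> as multisets
  (\<open>charpoly_eigenbasis\<close>), so sums over the one family equal sums over the other
  (\<open>sum_linear_factors_cong\<close>).

  In the tight case both bounds coincide, and taking traces in \<open>S = A I\<close> gives the value of \<open>A\<close>,
  because the trace of an orthogonal projection is the dimension of its range
  (\<open>trace_proj_matrix\<close>).
\<close>

section \<open>Spectral theorem for real symmetric matrices\<close>

text \<open>A unit vector \<open>v\<close> of \<open>U\<close> maximising \<open>u \<bullet> f u\<close> is an eigenvector: with \<open>c\<close> the maximum and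
  \<open>g = f v - c v\<close>, the form \<open>q u = c (u \<bullet> u) - u \<bullet> f u\<close> is nonnegative on \<open>U\<close> and vanishes at \<open>v\<close>,
  while \<open>q (v + t g) = t\<^sup>2 q g - 2 t (g \<bullet> g)\<close>; for small \<open>t > 0\<close> this would be negative if \<open>g \<noteq> 0\<close>.\<close>

lemma selfadjoint_eigenvector_in_subspace:
  fixes f :: "'a::euclidean_space \<Rightarrow> 'a"
  assumes lin: "linear f" and adj: "\<And>x y. f x \<bullet> y = x \<bullet> f y"
    and U: "subspace U" and inv: "\<And>u. u \<in> U \<Longrightarrow> f u \<in> U"
    and a: "a \<in> U" "a \<noteq> 0"
  obtains v c where "v \<in> U" "norm v = 1" "f v = c *\<^sub>R v"
proof -
  have "compact (U \<inter> sphere 0 1)"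
    by (metis U closed_Int_compact closed_subspace compact_sphere)
  moreover have "(1 / norm a) *\<^sub>R a \<in> U \<inter> sphere 0 1"
    using a U by (simp add: subspace_scale)
  moreover have "continuous_on (U \<inter> sphere 0 1) (\<lambda>u. u \<bullet> f u)"
    by (intro continuous_intros linear_continuous_on linear_conv_bounded_linear[THEN iffD1, OF lin])
  ultimately obtain v where "v \<in> U \<inter> sphere 0 1"
    and "\<forall>u\<in>U \<inter> sphere 0 1. u \<bullet> f u \<le> v \<bullet> f v"
    using continuous_attains_sup[of "U \<inter> sphere 0 1" "\<lambda>u. u \<bullet> f u"] by blast
  then have v: "v \<in> U" "norm v = 1"
    and vmax: "\<And>u. u \<in> U \<Longrightarrow> norm u = 1 \<Longrightarrow> u \<bullet> f u \<le> v \<bullet> f v"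
    by simp_all
  define c where "c = v \<bullet> f v"
  define g where "g = f v - c *\<^sub>R v"
  define q where "q u = c * (u \<bullet> u) - u \<bullet> f u" for u
  have vv: "v \<bullet> v = 1"
    using v by (simp add: dot_square_norm)
  have gU: "g \<in> U"
    unfolding g_def using U inv v by (simp add: subspace_diff subspace_scale)
  have q_nonneg: "0 \<le> q u" if "u \<in> U" for u
  proof (cases "u = 0")
    case True
    then show ?thesis
      by (simp add: q_def)
  next
    case False
    have "((1 / norm u) *\<^sub>R u) \<bullet> f ((1 / norm u) *\<^sub>R u) \<le> c"
      unfolding c_def using that U False by (intro vmax) (simp_all add: subspace_scale)
    then show ?thesis
      using False by (simp add: q_def linear_scale[OF lin] divide_simps dot_square_norm power2_eq_square)
  qed
  have q_line: "q (v + t *\<^sub>R g) = t * (t * q g) - 2 * t * (g \<bullet> g)" for t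
  proof -
    have vg: "v \<bullet> f g = g \<bullet> g + c * (v \<bullet> g)"
    proof -
      have "v \<bullet> f g = (g + c *\<^sub>R v) \<bullet> g"
        unfolding adj[symmetric] by (simp add: g_def)
      then show ?thesis
        by (simp add: inner_add_left)
    qed
    have gv: "g \<bullet> f v = g \<bullet> g + c * (v \<bullet> g)"
      by (metis adj inner_commute vg)
    show ?thesis
      unfolding q_def linear_add[OF lin] linear_scale[OF lin]
      using vg gv by (simp add: c_def[symmetric] vv inner_commute algebra_simps)
  qed
  have "g = 0"
  proof (rule ccontr)
    assume "g \<noteq> 0"
    define G where "G = g \<bullet> g"
    have G: "0 < G"
      using \<open>g \<noteq> 0\<close> by (simp add: G_def)
    have qg: "0 \<le> q g"
      by (rule q_nonneg[OF gU])
    (* Any positive t with t * q g < 2 G would do; adding 1 keeps the denominator positive. *)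
    define t where "t = G / (q g + 1)"
    have "0 \<le> G * q g"
      using G qg by simp
    then have "G * q g < 2 * G * (q g + 1)"
      using G by (simp add: algebra_simps)
    then have t: "0 < t" "t * q g < 2 * G"
      using G qg unfolding t_def by (simp_all add: pos_divide_less_eq)
    have "0 \<le> q (v + t *\<^sub>R g)"
      using U gU v by (intro q_nonneg) (simp add: subspace_add subspace_scale)
    then have "0 \<le> t * (t * q g - 2 * G)"
      unfolding q_line G_def by (simp add: algebra_simps)
    with t show False
      by (simp add: zero_le_mult_iff)
  qed
  then have "f v = c *\<^sub>R v"
    by (simp add: g_def)
  with v that show thesis
    by blast
qed

text \<open>An orthonormal set of eigenvectors of maximal size spans: its orthogonal complement is
  invariant, so otherwise it would contain one more eigenvector.\<close>

lemma selfadjoint_orthonormal_eigenbasis: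
  fixes f :: "'a::euclidean_space \<Rightarrow> 'a"
  assumes lin: "linear f" and adj: "\<And>x y. f x \<bullet> y = x \<bullet> f y"
  obtains B where "pairwise orthogonal B" "\<And>b. b \<in> B \<Longrightarrow> norm b = 1"
    "\<And>b. b \<in> B \<Longrightarrow> \<exists>c. f b = c *\<^sub>R b" "finite B" "card B = DIM('a)"
proof -
  define orthonormal_eigenset where "orthonormal_eigenset B \<longleftrightarrow>
      pairwise orthogonal B \<and> (\<forall>b\<in>B. norm b = 1 \<and> (\<exists>c. f b = c *\<^sub>R b))"
    for B :: "'a set"
  have indep: "independent B" if "orthonormal_eigenset B" for B
    using that by (intro pairwise_orthogonal_independent) (auto simp: orthonormal_eigenset_def)
  have "orthonormal_eigenset {}"
    by (simp add: orthonormal_eigenset_def)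
  moreover have "card B \<le> DIM('a)" if "orthonormal_eigenset B" for B
    using independent_bound[OF indep[OF that]] by simp
  ultimately have "\<exists>B. orthonormal_eigenset B \<and> (\<forall>C. orthonormal_eigenset C \<longrightarrow> card C \<le> card B)"
    by (intro ex_has_greatest_nat[of orthonormal_eigenset "{}" card "Suc DIM('a)"])
      (auto simp: less_Suc_eq_le)
  then obtain B where B: "orthonormal_eigenset B" and Bmax: "\<And>C. orthonormal_eigenset C \<Longrightarrow> card C \<le> card B"
    by auto
  have fin: "finite B"
    using independent_bound[OF indep[OF B]] by simp
  have "span B = UNIV"
  proof (rule ccontr)
    assume "span B \<noteq> UNIV"
    then obtain a where a: "a \<noteq> 0" "\<forall>x\<in>span B. a \<bullet> x = 0"
      using span_not_UNIV_orthogonal by blast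
    define U where "U = {u. \<forall>b\<in>B. b \<bullet> u = 0}"
    have "subspace U"
      by (auto simp: U_def subspace_def inner_add_right)
    moreover have "f u \<in> U" if "u \<in> U" for u
      unfolding U_def
    proof (clarify)
      fix b assume "b \<in> B"
      then obtain c where "f b = c *\<^sub>R b"
        using B by (auto simp: orthonormal_eigenset_def)
      then show "b \<bullet> f u = 0"
        using \<open>b \<in> B\<close> that adj[of b u] by (simp add: U_def)
    qed
    moreover have "a \<in> U"
      using a by (simp add: U_def span_base inner_commute)
    ultimately obtain v c where v: "v \<in> U" "norm v = 1" "f v = c *\<^sub>R v"
      using selfadjoint_eigenvector_in_subspace[OF lin adj] a(1) by metis
    have "v \<notin> B"
      using v by (auto simp: U_def)
    moreover have "orthonormal_eigenset (insert v B)"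
      using B v by (auto simp: orthonormal_eigenset_def pairwise_insert orthogonal_def U_def inner_commute)
    ultimately show False
      using Bmax[of "insert v B"] fin by simp
  qed
  then have "card B = DIM('a)"
    using indep[OF B] by (metis dim_UNIV dim_span_eq_card_independent)
  then show thesis
    using that B fin by (auto simp: orthonormal_eigenset_def)
qed

lemma symmetric_matrix_eigenbasis:
  fixes R :: "real ^ 'm ^ 'm"
  assumes "transpose R = R"
  obtains v :: "'m \<Rightarrow> real ^ 'm" and \<mu>
  where "\<And>i j. v i \<bullet> v j = (if i = j then 1 else 0)" "\<And>i. R *v v i = \<mu> i *\<^sub>R v i"
proof -
  have "(R *v x) \<bullet> y = x \<bullet> (R *v y)" for x y
    by (metis assms dot_lmul_matrix transpose_matrix_vector)
  then obtain B where B: "pairwise orthogonal B" "\<And>b. b \<in> B \<Longrightarrow> norm b = 1"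
    "\<And>b. b \<in> B \<Longrightarrow> \<exists>c. R *v b = c *\<^sub>R b" "finite B" "card B = CARD('m)"
    using selfadjoint_orthonormal_eigenbasis[of "(*v) R"] by auto
  then obtain v where v: "bij_betw v (UNIV :: 'm set) B"
    by (metis finite_class.finite_UNIV finite_same_card_bij)
  have vB: "v i \<in> B" for i
    using v by (auto simp: bij_betw_def)
  have "v i \<bullet> v j = (if i = j then 1 else 0)" for i j
  proof (cases "i = j")
    case True
    then show ?thesis
      using B(2)[OF vB] by (simp add: dot_square_norm)
  next
    case False
    then have "v i \<noteq> v j"
      using v by (auto simp: bij_betw_def inj_on_def)
    then show ?thesis
      using False B(1) vB by (auto simp: pairwise_def orthogonal_def)
  qed
  moreover obtain \<mu> where "\<And>i. R *v v i = \<mu> i *\<^sub>R v i"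
    using B(3)[OF vB] by metis
  ultimately show thesis
    using that by blast
qed

section \<open>Orthonormal families indexed by the coordinates\<close>

lemma orthonormal_family_matrix:
  fixes v :: "'m::finite \<Rightarrow> real ^ 'm"
  assumes "\<And>i j. v i \<bullet> v j = (if i = j then 1 else 0)"
  shows "(\<chi> i. v i) ** transpose (\<chi> i. v i) = mat 1" "transpose (\<chi> i. v i) ** (\<chi> i. v i) = mat 1"
proof -
  show *: "(\<chi> i. v i) ** transpose (\<chi> i. v i) = mat 1"
    using assms by (simp add: matrix_matrix_mult_def transpose_def mat_def inner_vec_def vec_eq_iff)
  then show "transpose (\<chi> i. v i) ** (\<chi> i. v i) = mat 1"
    by (simp add: matrix_left_right_inverse)
qed

lemma orthonormal_family_complete:
  fixes v :: "'m::finite \<Rightarrow> real ^ 'm"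
  assumes "\<And>i j. v i \<bullet> v j = (if i = j then 1 else 0)"
  shows "(\<Sum>k\<in>UNIV. v k $ a * v k $ b) = (if a = b then 1 else 0)"
  using orthonormal_family_matrix(2)[of v, OF assms]
  by (simp add: matrix_matrix_mult_def transpose_def mat_def vec_eq_iff)

lemma orthonormal_family_parseval:
  fixes v :: "'m::finite \<Rightarrow> real ^ 'm"
  assumes "\<And>i j. v i \<bullet> v j = (if i = j then 1 else 0)"
  shows "x \<bullet> y = (\<Sum>k\<in>UNIV. (x \<bullet> v k) * (v k \<bullet> y))"
proof -
  let ?Q = "\<chi> i. v i"
  have "x \<bullet> y = x \<bullet> (transpose ?Q *v (?Q *v y))"
    unfolding matrix_vector_mul_assoc orthonormal_family_matrix(2)[of v, OF assms] by simp
  also have "\<dots> = (?Q *v x) \<bullet> (?Q *v y)"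
    by (metis dot_lmul_matrix transpose_matrix_vector transpose_transpose)
  also have "\<dots> = (\<Sum>k\<in>UNIV. (x \<bullet> v k) * (v k \<bullet> y))"
    by (simp add: inner_vec_def[of "?Q *v x"] matrix_vector_mul_component inner_commute)
  finally show ?thesis .
qed

lemma trace_orthonormal_family:
  fixes v :: "'m::finite \<Rightarrow> real ^ 'm"
  assumes "\<And>i j. v i \<bullet> v j = (if i = j then 1 else 0)"
  shows "trace A = (\<Sum>k\<in>UNIV. v k \<bullet> (A *v v k))"
proof -
  have "(\<Sum>k\<in>UNIV. v k \<bullet> (A *v v k)) = (\<Sum>k\<in>UNIV. \<Sum>a\<in>UNIV. \<Sum>b\<in>UNIV. A $ a $ b * (v k $ a * v k $ b))"
    by (simp add: inner_vec_def matrix_vector_mult_def sum_distrib_left mult_ac)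
  also have "\<dots> = (\<Sum>a\<in>UNIV. \<Sum>k\<in>UNIV. \<Sum>b\<in>UNIV. A $ a $ b * (v k $ a * v k $ b))"
    by (rule sum.swap)
  also have "\<dots> = (\<Sum>a\<in>UNIV. \<Sum>b\<in>UNIV. \<Sum>k\<in>UNIV. A $ a $ b * (v k $ a * v k $ b))"
    by (intro sum.cong refl sum.swap)
  also have "\<dots> = trace A"
    unfolding sum_distrib_left[symmetric] orthonormal_family_complete[of v, OF assms]
    by (simp add: trace_def if_distrib cong: if_cong)
  finally show ?thesis ..
qed

section \<open>Characteristic polynomial and eigenvalues\<close>

lemma matrix_diff_ldistrib: "A ** (B - C) = A ** B - A ** (C :: 'a::ring_1 ^ 'p ^ 'n)"
  by (simp add: matrix_matrix_mult_def vec_eq_iff right_diff_distrib sum_subtractf)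

lemma matrix_add_rdistrib: "(A + B) ** C = A ** C + B ** (C :: 'a::ring_1 ^ 'p ^ 'n)"
  by (simp add: matrix_matrix_mult_def vec_eq_iff distrib_right sum.distrib)

lemma matrix_diff_rdistrib: "(A - B) ** C = A ** C - B ** (C :: 'a::ring_1 ^ 'p ^ 'n)"
  by (simp add: matrix_matrix_mult_def vec_eq_iff left_diff_distrib sum_subtractf)

lemma const_poly_sum:
  fixes a :: "_ \<Rightarrow> 'a::comm_ring_1"
  shows "[:\<Sum>k\<in>S. a k:] = (\<Sum>k\<in>S. [:a k:])"
proof (induction S rule: infinite_finite_induct)
  case (insert k S)
  have "[:a k + sum a S:] = [:a k:] + [:sum a S:]"
    by simp
  with insert show ?case
    by (simp del: add_pCons)
qed auto

text \<open>Over the polynomial ring, \<open>Q (X - R) = (X - D) Q\<close>; a left inverse of \<open>Q\<close> makes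
  \<open>det Q\<close> a unit, so it cancels from the determinants.\<close>

lemma charpoly_intertwined:
  fixes Q R D :: "real ^ 'm ^ 'm"
  assumes inv: "Q' ** Q = mat 1" and QR: "Q ** R = D ** Q"
  shows "charpoly R = charpoly D"
proof -
  define K :: "real ^ 'm ^ 'm \<Rightarrow> real poly ^ 'm ^ 'm" where "K M = (\<chi> i j. [:M $ i $ j:])" for M
  define C :: "real ^ 'm ^ 'm \<Rightarrow> real poly ^ 'm ^ 'm"
    where "C M = (\<chi> i j. (if i = j then [:0, 1:] else 0) - [:M $ i $ j:])" for M
  have K_mult: "K M ** K N = K (M ** N)" for M N
    by (simp add: K_def matrix_matrix_mult_def vec_eq_iff const_poly_sum mult.commute)
  have "K Q' ** K Q = mat 1"
    unfolding K_mult inv by (simp add: K_def mat_def vec_eq_iff one_pCons)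
  then have "det (K Q') * det (K Q) = 1"
    by (metis det_mul det_I)
  then have nz: "det (K Q) \<noteq> 0"
    by auto
  have C_eq: "C M = mat [:0, 1:] - K M" for M
    by (simp add: C_def K_def mat_def vec_eq_iff)
  have "mat [:0, 1:] ** K Q = K Q ** mat [:0, 1:]"
    by (simp add: mat_def matrix_matrix_mult_def vec_eq_iff if_distrib if_distribR
        mult.commute cong: if_cong)
  then have "K Q ** C R = C D ** K Q"
    unfolding C_eq by (simp add: matrix_diff_ldistrib matrix_diff_rdistrib K_mult QR)
  then have "det (K Q) * det (C R) = det (C D) * det (K Q)"
    unfolding det_mul[symmetric] by simp
  then have "det (C R) = det (C D)"
    using nz by simp
  then show ?thesis
    by (simp add: charpoly_def C_def)
qed

lemma charpoly_eigenbasis: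
  fixes v :: "'m::finite \<Rightarrow> real ^ 'm"
  assumes on: "\<And>i j. v i \<bullet> v j = (if i = j then 1 else 0)"
    and sym: "transpose R = R" and eig: "\<And>i. R *v v i = \<mu> i *\<^sub>R v i"
  shows "charpoly R = (\<Prod>i\<in>UNIV. [:- \<mu> i, 1:])"
proof -
  define Q where "Q = (\<chi> i. v i)"
  define D :: "real ^ 'm ^ 'm" where "D = (\<chi> i j. if i = j then \<mu> i else 0)"
  have "(Q ** R) $ i = (D ** Q) $ i" for i
  proof -
    have "(Q ** R) $ i = transpose R *v v i"
      by (simp add: Q_def matrix_matrix_mult_def matrix_vector_mult_def transpose_def vec_eq_iff mult.commute)
    also have "\<dots> = (D ** Q) $ i"
      unfolding sym eig
      by (simp add: D_def Q_def matrix_matrix_mult_def vec_eq_iff if_distrib if_distribR cong: if_cong)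
    finally show ?thesis .
  qed
  then have "charpoly R = charpoly D"
    using charpoly_intertwined[of "transpose Q" Q R D] orthonormal_family_matrix(2)[of v, OF on]
    by (simp add: Q_def vec_eq_iff)
  also have "\<dots> = (\<Prod>i\<in>UNIV. [:- \<mu> i, 1:])"
    unfolding charpoly_def by (subst det_diagonal) (auto simp: D_def)
  finally show ?thesis .
qed

lemma proots_prod_linear_factors:
  fixes a :: "_ \<Rightarrow> real"
  shows "proots (\<Prod>i\<in>I. [:- a i, 1:]) = (\<Sum>i\<in>I. {#a i#})"
  by (subst proots_prod) auto

text \<open>Either side is the sum of \<open>f\<close> over the multiset of roots of the common product.\<close>

lemma sum_linear_factors_cong:
  fixes a :: "'i \<Rightarrow> real" and b :: "'j \<Rightarrow> real" and f :: "real \<Rightarrow> real"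
  assumes "(\<Prod>i\<in>I. [:- a i, 1:]) = (\<Prod>j\<in>J. [:- b j, 1:])"
  shows "(\<Sum>i\<in>I. f (a i)) = (\<Sum>j\<in>J. f (b j))"
proof -
  have "(\<Sum>i\<in>I. f (a i)) = (\<Sum>y\<in>#proots (\<Prod>i\<in>I. [:- a i, 1:]). f y)" for I :: "'k set" and a
    unfolding proots_prod_linear_factors by (induction I rule: infinite_finite_induct) auto
  then show ?thesis
    using assms by metis
qed

section \<open>Trace of an inverse matrix\<close>

text \<open>If \<open>w = X v\<^sub>k\<close> and \<open>t = v\<^sub>k \<bullet> w\<close>, then \<open>t = w \<bullet> Y w \<ge> \<zeta>\<^sub>k t\<^sup>2\<close>, because \<open>t\<close> is one of the
  coordinates of \<open>w\<close>; hence \<open>t \<le> 1/\<zeta>\<^sub>k\<close>, and the trace of \<open>X\<close> is the sum of these numbers \<open>t\<close>.\<close>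

lemma trace_inverse_le:
  fixes v :: "'m::finite \<Rightarrow> real ^ 'm"
  assumes on: "\<And>i j. v i \<bullet> v j = (if i = j then 1 else 0)"
    and inv: "Y ** X = mat 1" and pos: "\<And>k. 0 < \<zeta> k"
    and below: "\<And>w. (\<Sum>k\<in>UNIV. \<zeta> k * (w \<bullet> v k)\<^sup>2) \<le> w \<bullet> (Y *v w)"
  shows "trace X \<le> (\<Sum>k\<in>UNIV. 1 / \<zeta> k)"
  unfolding trace_orthonormal_family[of v, OF on]
proof (rule sum_mono)
  fix k
  define w where "w = X *v v k"
  define t where "t = v k \<bullet> w"
  have Yw: "Y *v w = v k"
    by (simp add: w_def matrix_vector_mul_assoc inv)
  have "\<zeta> k * t\<^sup>2 = (\<Sum>j\<in>{k}. \<zeta> j * (w \<bullet> v j)\<^sup>2)"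
    by (simp add: t_def inner_commute)
  also have "\<dots> \<le> (\<Sum>j\<in>UNIV. \<zeta> j * (w \<bullet> v j)\<^sup>2)"
    by (rule sum_mono2) (auto intro: mult_nonneg_nonneg less_imp_le[OF pos])
  also have "\<dots> \<le> t"
    using below[of w] by (simp add: Yw t_def inner_commute)
  finally have *: "(\<zeta> k * t) * t \<le> 1 * t"
    by (simp add: power2_eq_square mult_ac)
  have "\<zeta> k * t \<le> 1"
  proof (cases "0 < t")
    case True
    with * show ?thesis
      by (simp only: mult_le_cancel_right_pos)
  next
    case False
    then show ?thesis
      using mult_nonneg_nonpos[of "\<zeta> k" t] less_imp_le[OF pos[of k]] by simp
  qed
  then show "v k \<bullet> (X *v v k) \<le> 1 / \<zeta> k"
    using pos[of k] by (simp add: t_def w_def pos_le_divide_eq mult.commute)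
qed

text \<open>Dually, \<open>Y\<close> is positive semidefinite, and evaluating its form at \<open>X v\<^sub>k - v\<^sub>k/\<zeta>\<^sub>k\<close> bounds
  \<open>v\<^sub>k \<bullet> X v\<^sub>k\<close> from below.\<close>

lemma trace_inverse_ge:
  fixes v :: "'m::finite \<Rightarrow> real ^ 'm"
  assumes on: "\<And>i j. v i \<bullet> v j = (if i = j then 1 else 0)"
    and inv: "Y ** X = mat 1" and pos: "\<And>k. 0 < \<zeta> k" and psd: "pos_semidef Y"
    and above: "\<And>w. w \<bullet> (Y *v w) \<le> (\<Sum>k\<in>UNIV. \<zeta> k * (w \<bullet> v k)\<^sup>2)"
  shows "(\<Sum>k\<in>UNIV. 1 / \<zeta> k) \<le> trace X"
  unfolding trace_orthonormal_family[of v, OF on]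
proof (rule sum_mono)
  fix k
  define w where "w = X *v v k"
  define s where "s = 1 / \<zeta> k"
  define t where "t = v k \<bullet> w"
  have Yw: "Y *v w = v k"
    by (simp add: w_def matrix_vector_mul_assoc inv)
  have YT: "transpose Y = Y"
    using psd by (simp add: pos_semidef_def)
  have wY: "w \<bullet> (Y *v v k) = 1"
  proof -
    have "w \<bullet> (Y *v v k) = (Y *v w) \<bullet> v k"
      by (metis YT dot_lmul_matrix transpose_matrix_vector)
    then show ?thesis
      by (simp add: Yw on)
  qed
  have vY: "v k \<bullet> (Y *v v k) \<le> \<zeta> k"
    using above[of "v k"] by (simp add: on if_distrib[of "\<lambda>x. x\<^sup>2"] if_distrib[of "(*) _"] cong: if_cong)
  have "0 \<le> (w - s *\<^sub>R v k) \<bullet> (Y *v (w - s *\<^sub>R v k))"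
    using psd by (simp add: pos_semidef_def)
  also have "\<dots> = t - 2 * s + s * (s * (v k \<bullet> (Y *v v k)))"
    by (simp add: matrix_vector_mult_diff_distrib matrix_vector_mult_scaleR inner_diff_left
        inner_diff_right Yw wY on t_def inner_commute[of w "v k"] algebra_simps)
  also have "\<dots> \<le> t - 2 * s + s * (s * \<zeta> k)"
    using mult_left_mono[OF mult_left_mono[OF vY], of s s] pos[of k] by (simp add: s_def)
  also have "\<dots> = t - s"
    using pos[of k] by (simp add: s_def)
  finally show "1 / \<zeta> k \<le> v k \<bullet> (X *v v k)"
    by (simp add: s_def t_def w_def)
qed

section \<open>Orthogonal projections\<close>

text \<open>The expansion satisfies the two conditions that define the projection; the difference \<open>d\<close> of two
  vectors satisfying them lies in \<open>W\<close> and is orthogonal to \<open>W\<close>, so \<open>d \<bullet> d = 0\<close>.\<close>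

lemma orth_proj_expansion:
  fixes W :: "(real ^ 'm) set"
  assumes W: "subspace W"
  obtains B where "finite B" "card B = dim W" "\<forall>b\<in>B. \<forall>c\<in>B. b \<bullet> c = (if b = c then 1 else 0)"
    "\<forall>x. orth_proj W x = (\<Sum>b\<in>B. (b \<bullet> x) *\<^sub>R b)"
proof -
  obtain B where B: "B \<subseteq> W" "pairwise orthogonal B" "\<And>x. x \<in> B \<Longrightarrow> norm x = 1"
    "independent B" "card B = dim W" "span B = W"
    using orthonormal_basis_subspace[OF W] by metis
  have fin: "finite B"
    using B(4) independent_bound by blast
  have unit: "b \<bullet> b = 1" if "b \<in> B" for b
    using B(3)[OF that] by (simp add: dot_square_norm)
  have orth: "b \<bullet> c = 0" if "b \<in> B" "c \<in> B" "b \<noteq> c" for b c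
    using B(2) that by (auto simp: pairwise_def orthogonal_def)
  have "orth_proj W x = (\<Sum>b\<in>B. (b \<bullet> x) *\<^sub>R b)" (is "_ = ?p") for x
    unfolding orth_proj_def
  proof (rule the_equality)
    have pW: "?p \<in> W"
      using B(1) by (intro subspace_sum[OF W] subspace_scale[OF W]) auto
    have "(x - ?p) \<bullet> c = 0" if c: "c \<in> B" for c
    proof -
      have "?p \<bullet> c = (\<Sum>b\<in>B. if b = c then c \<bullet> x else 0)"
        unfolding inner_sum_left by (rule sum.cong) (auto simp: unit[OF c] orth c)
      then show ?thesis
        using fin c by (simp add: inner_diff_left inner_commute[of x c])
    qed
    then have pO: "orthogonal (x - ?p) u" if "u \<in> W" for u
      using that B(6) orthogonal_to_span[of u B "x - ?p"] by (auto simp: orthogonal_def)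
    show "?p \<in> W \<and> (\<forall>u\<in>W. orthogonal (x - ?p) u)"
      using pW pO by blast
    fix w assume w: "w \<in> W \<and> (\<forall>u\<in>W. orthogonal (x - w) u)"
    have "w - ?p \<in> W"
      using w pW W by (simp add: subspace_diff)
    then have "(x - ?p) \<bullet> (w - ?p) = 0" "(x - w) \<bullet> (w - ?p) = 0"
      using w pO by (auto simp: orthogonal_def)
    then have "((x - ?p) - (x - w)) \<bullet> (w - ?p) = 0"
      unfolding inner_diff_left[of "x - ?p"] by simp
    then show "w = ?p"
      by simp
  qed
  with fin B(5) unit orth show thesis
    by (intro that[of B]) auto
qed

lemma proj_matrix_expansion:
  fixes W :: "(real ^ 'm) set"
  assumes W: "subspace W"
  obtains B where "finite B" "card B = dim W" "\<forall>b\<in>B. \<forall>c\<in>B. b \<bullet> c = (if b = c then 1 else 0)"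
    "proj_matrix W = (\<chi> i j. \<Sum>b\<in>B. b $ i * b $ j)"
proof -
  obtain B where B: "finite B" "card B = dim W" "\<forall>b\<in>B. \<forall>c\<in>B. b \<bullet> c = (if b = c then 1 else 0)"
    "\<forall>x. orth_proj W x = (\<Sum>b\<in>B. (b \<bullet> x) *\<^sub>R b)"
    by (rule orth_proj_expansion[OF W])
  have "proj_matrix W = (\<chi> i j. \<Sum>b\<in>B. b $ i * b $ j)"
    by (simp add: proj_matrix_def matrix_def B(4) inner_axis vec_eq_iff mult.commute)
  with B that show thesis
    by blast
qed

lemma transpose_proj_matrix:
  assumes "subspace W"
  shows "transpose (proj_matrix W) = proj_matrix W"
proof -
  obtain B where "proj_matrix W = (\<chi> i j. \<Sum>b\<in>B. b $ i * b $ j)"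
    by (rule proj_matrix_expansion[OF assms]) (rule that)
  then show ?thesis
    by (simp add: transpose_def vec_eq_iff mult.commute)
qed

lemma proj_matrix_idem:
  fixes W :: "(real ^ 'm) set"
  assumes "subspace W"
  shows "proj_matrix W ** proj_matrix W = proj_matrix W"
proof -
  obtain B where B: "finite B" "card B = dim W" "\<forall>b\<in>B. \<forall>c\<in>B. b \<bullet> c = (if b = c then 1 else 0)"
    and P: "proj_matrix W = (\<chi> i j. \<Sum>b\<in>B. b $ i * b $ j)"
    by (rule proj_matrix_expansion[OF assms])
  have "(\<Sum>k\<in>UNIV. (\<Sum>b\<in>B. b $ i * b $ k) * (\<Sum>c\<in>B. c $ k * c $ j)) = (\<Sum>b\<in>B. b $ i * b $ j)" for i j
  proof -
    have "(\<Sum>k\<in>UNIV. (\<Sum>b\<in>B. b $ i * b $ k) * (\<Sum>c\<in>B. c $ k * c $ j))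
      = (\<Sum>k\<in>UNIV. \<Sum>b\<in>B. \<Sum>c\<in>B. b $ i * c $ j * (b $ k * c $ k))"
      by (simp add: sum_product mult_ac)
    also have "\<dots> = (\<Sum>b\<in>B. \<Sum>k\<in>UNIV. \<Sum>c\<in>B. b $ i * c $ j * (b $ k * c $ k))"
      by (rule sum.swap)
    also have "\<dots> = (\<Sum>b\<in>B. \<Sum>c\<in>B. \<Sum>k\<in>UNIV. b $ i * c $ j * (b $ k * c $ k))"
      by (intro sum.cong refl sum.swap)
    also have "\<dots> = (\<Sum>b\<in>B. \<Sum>c\<in>B. b $ i * c $ j * (b \<bullet> c))"
      by (simp add: inner_vec_def sum_distrib_left)
    also have "\<dots> = (\<Sum>b\<in>B. \<Sum>c\<in>B. if c = b then b $ i * b $ j else 0)"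
      by (intro sum.cong refl) (auto simp: B(3))
    also have "\<dots> = (\<Sum>b\<in>B. b $ i * b $ j)"
      using B(1) by simp
    finally show ?thesis .
  qed
  then show ?thesis
    by (simp add: P matrix_matrix_mult_def vec_eq_iff)
qed

lemma trace_proj_matrix:
  fixes W :: "(real ^ 'm) set"
  assumes "subspace W"
  shows "trace (proj_matrix W) = real (dim W)"
proof -
  obtain B where B: "finite B" "card B = dim W" "\<forall>b\<in>B. \<forall>c\<in>B. b \<bullet> c = (if b = c then 1 else 0)"
    and P: "proj_matrix W = (\<chi> i j. \<Sum>b\<in>B. b $ i * b $ j)"
    by (rule proj_matrix_expansion[OF assms])
  have "trace (proj_matrix W) = (\<Sum>b\<in>B. b \<bullet> b)"
    by (simp add: trace_def P inner_vec_def sum.swap[of _ B])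
  then show ?thesis
    using B by simp
qed

section \<open>Second-moment matrices\<close>

lemma measurable_vec_nth:
  fixes u :: "'w \<Rightarrow> real ^ 'm"
  assumes "u \<in> borel_measurable M"
  shows "(\<lambda>\<omega>. u \<omega> $ i) \<in> borel_measurable M"
  using borel_measurable_inner[OF assms borel_measurable_const[of "axis i 1"]]
  by (simp add: inner_axis)

lemma square_integrable_rv_product:
  assumes "square_integrable_rv M u" "square_integrable_rv M v"
  shows "integrable M (\<lambda>\<omega>. u \<omega> $ i * v \<omega> $ j)"
proof (rule Bochner_Integration.integrable_bound)
  show "integrable M (\<lambda>\<omega>. (norm (u \<omega>))\<^sup>2 + (norm (v \<omega>))\<^sup>2)"
    using assms by (auto simp: square_integrable_rv_def)
  show "(\<lambda>\<omega>. u \<omega> $ i * v \<omega> $ j) \<in> borel_measurable M"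
    using assms by (auto intro!: borel_measurable_times measurable_vec_nth simp: square_integrable_rv_def)
  show "AE \<omega> in M. norm (u \<omega> $ i * v \<omega> $ j) \<le> norm ((norm (u \<omega>))\<^sup>2 + (norm (v \<omega>))\<^sup>2)"
  proof (rule AE_I2)
    fix \<omega>
    have "norm (u \<omega> $ i * v \<omega> $ j) \<le> norm (u \<omega>) * norm (v \<omega>)"
      unfolding norm_mult by (intro mult_mono) (auto simp: component_le_norm_cart)
    also have "\<dots> \<le> 2 * norm (u \<omega>) * norm (v \<omega>)"
      by simp
    also have "\<dots> \<le> (norm (u \<omega>))\<^sup>2 + (norm (v \<omega>))\<^sup>2"
      by (rule sum_squares_bound)
    finally show "norm (u \<omega> $ i * v \<omega> $ j) \<le> norm ((norm (u \<omega>))\<^sup>2 + (norm (v \<omega>))\<^sup>2)"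
      by simp
  qed
qed

lemma square_integrable_rv_add:
  assumes "square_integrable_rv M u" "square_integrable_rv M v"
  shows "square_integrable_rv M (\<lambda>\<omega>. u \<omega> + v \<omega>)"
proof -
  have "integrable M (\<lambda>\<omega>. (norm (u \<omega> + v \<omega>))\<^sup>2)"
  proof (rule Bochner_Integration.integrable_bound)
    show "integrable M (\<lambda>\<omega>. 2 * (norm (u \<omega>))\<^sup>2 + 2 * (norm (v \<omega>))\<^sup>2)"
      using assms by (auto simp: square_integrable_rv_def)
    show "(\<lambda>\<omega>. (norm (u \<omega> + v \<omega>))\<^sup>2) \<in> borel_measurable M"
      using assms by (auto simp: square_integrable_rv_def)
    have "(norm (a + b))\<^sup>2 \<le> 2 * (norm a)\<^sup>2 + 2 * (norm b)\<^sup>2" for a b :: "real ^ 'b"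
    proof -
      have "(norm (a + b))\<^sup>2 \<le> (norm a + norm b)\<^sup>2"
        by (intro power_mono norm_triangle_ineq) simp
      then show ?thesis
        using sum_squares_bound[of "norm a" "norm b"] by (simp add: power2_sum)
    qed
    then show "AE \<omega> in M. norm ((norm (u \<omega> + v \<omega>))\<^sup>2) \<le> norm (2 * (norm (u \<omega>))\<^sup>2 + 2 * (norm (v \<omega>))\<^sup>2)"
      by simp
  qed
  then show ?thesis
    using assms by (auto simp: square_integrable_rv_def)
qed

lemma square_integrable_rv_matrix:
  fixes C :: "real ^ 'k ^ 'm"
  assumes "square_integrable_rv M u"
  shows "square_integrable_rv M (\<lambda>\<omega>. C *v u \<omega>)"
proof -
  have meas: "(\<lambda>\<omega>. C *v u \<omega>) \<in> borel_measurable M"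
    using assms unfolding square_integrable_rv_def
    by (auto intro: measurable_compose[OF _ borel_measurable_continuous_onI] linear_continuous_on
        linear_conv_bounded_linear[THEN iffD1])
  obtain K where K: "\<And>x. norm (C *v x) \<le> K * norm x"
    using linear_bounded[of "(*v) C"] by auto
  have "integrable M (\<lambda>\<omega>. (norm (C *v u \<omega>))\<^sup>2)"
  proof (rule Bochner_Integration.integrable_bound)
    show "integrable M (\<lambda>\<omega>. K\<^sup>2 * (norm (u \<omega>))\<^sup>2)"
      using assms by (auto simp: square_integrable_rv_def)
    show "(\<lambda>\<omega>. (norm (C *v u \<omega>))\<^sup>2) \<in> borel_measurable M"
      using meas by measurable
    have "(norm (C *v x))\<^sup>2 \<le> K\<^sup>2 * (norm x)\<^sup>2" for x
      using power_mono[OF K[of x], of 2] by (simp add: power_mult_distrib)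
    then show "AE \<omega> in M. norm ((norm (C *v u \<omega>))\<^sup>2) \<le> norm (K\<^sup>2 * (norm (u \<omega>))\<^sup>2)"
      by simp
  qed
  with meas show ?thesis
    by (simp add: square_integrable_rv_def)
qed

lemma square_integrable_rv_stack:
  assumes "\<And>i. square_integrable_rv M (u i)"
  shows "square_integrable_rv M (\<lambda>\<omega>. stack (\<lambda>i. u i \<omega>))"
proof -
  have "(\<lambda>\<omega>. stack (\<lambda>i. u i \<omega>)) \<in> borel_measurable M"
  proof (rule borel_measurable_euclidean_space[THEN iffD2], rule ballI)
    fix b :: "real ^ ('a \<times> 'c)" assume "b \<in> Basis"
    then obtain k where b: "b = axis k 1"
      by (auto simp: Basis_vec_def)
    have "(\<lambda>\<omega>. u (fst k) \<omega> $ snd k) \<in> borel_measurable M"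
      using assms[of "fst k"] by (auto intro: measurable_vec_nth simp: square_integrable_rv_def)
    then show "(\<lambda>\<omega>. stack (\<lambda>i. u i \<omega>) \<bullet> b) \<in> borel_measurable M"
      by (simp add: b inner_axis stack_def)
  qed
  moreover have "integrable M (\<lambda>\<omega>. (norm (stack (\<lambda>i. u i \<omega>)))\<^sup>2)"
    using square_integrable_rv_product[OF assms assms]
    by (simp add: power2_norm_eq_inner inner_vec_def stack_def)
  ultimately show ?thesis
    by (simp add: square_integrable_rv_def)
qed

lemma corr_matrix_transpose: "corr_matrix M v u = transpose (corr_matrix M u v)"
  by (simp add: corr_matrix_def transpose_def vec_eq_iff mult.commute)

lemma corr_matrix_add_left:
  assumes "square_integrable_rv M u" "square_integrable_rv M u'" "square_integrable_rv M v"
  shows "corr_matrix M (\<lambda>\<omega>. u \<omega> + u' \<omega>) v = corr_matrix M u v + corr_matrix M u' v"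
  using assms by (simp add: corr_matrix_def vec_eq_iff distrib_right square_integrable_rv_product)

lemma corr_matrix_mult_left:
  assumes "square_integrable_rv M u" "square_integrable_rv M v"
  shows "corr_matrix M (\<lambda>\<omega>. C *v u \<omega>) v = C ** corr_matrix M u v"
  using assms by (simp add: corr_matrix_def vec_eq_iff matrix_vector_mult_def matrix_matrix_mult_def
      sum_distrib_right mult.assoc square_integrable_rv_product)

lemma corr_matrix_add_right:
  assumes "square_integrable_rv M u" "square_integrable_rv M v" "square_integrable_rv M v'"
  shows "corr_matrix M u (\<lambda>\<omega>. v \<omega> + v' \<omega>) = corr_matrix M u v + corr_matrix M u v'"
  using assms by (simp add: corr_matrix_def vec_eq_iff distrib_left square_integrable_rv_product)

lemma corr_matrix_mult_right:
  assumes "square_integrable_rv M u" "square_integrable_rv M v"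
  shows "corr_matrix M u (\<lambda>\<omega>. C *v v \<omega>) = corr_matrix M u v ** transpose C"
  by (metis assms corr_matrix_mult_left corr_matrix_transpose matrix_transpose_mul)

section \<open>Linear estimation\<close>

text \<open>Orthogonality principle: the normal equation \<open>F R\<^sub>z\<^sub>z = R\<^sub>x\<^sub>z\<close> says that the error
  \<open>e = x - F z\<close> satisfies \<open>E[e z\<^sup>T] = 0\<close>, so that \<open>E[e e\<^sup>T] = E[e x\<^sup>T]\<close>.\<close>

lemma lmmse_error_eq_trace:
  fixes x :: "'w \<Rightarrow> real ^ 'm" and z :: "'w \<Rightarrow> real ^ 'k"
  assumes x: "square_integrable_rv M x" and z: "square_integrable_rv M z"
    and normal: "lmmse_matrix M x z ** corr_matrix M z z = corr_matrix M x z"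
  shows "lmmse_error M x z = trace (corr_matrix M x x - lmmse_matrix M x z ** corr_matrix M z x)"
proof -
  define F where "F = lmmse_matrix M x z"
  define e where "e \<omega> = x \<omega> + (- F) *v z \<omega>" for \<omega>
  have neg: "(- F) ** C = - (F ** C)" for C :: "real ^ 'p ^ 'k"
    by (simp add: matrix_matrix_mult_def vec_eq_iff sum_negf)
  have Fz: "square_integrable_rv M (\<lambda>\<omega>. (- F) *v z \<omega>)"
    by (rule square_integrable_rv_matrix[OF z])
  have e: "square_integrable_rv M e"
    unfolding e_def by (rule square_integrable_rv_add[OF x Fz])
  have ex: "corr_matrix M e x = corr_matrix M x x - F ** corr_matrix M z x"
    unfolding e_def corr_matrix_add_left[OF x Fz x] corr_matrix_mult_left[OF z x] neg by simp
  have ez: "corr_matrix M e z = 0"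
    using normal unfolding e_def corr_matrix_add_left[OF x Fz z] corr_matrix_mult_left[OF z z] neg
    by (simp add: F_def)
  have "corr_matrix M e e = corr_matrix M e x"
    using corr_matrix_add_right[OF e x Fz]
    unfolding corr_matrix_mult_right[OF e z] ez e_def[symmetric]
    by (simp add: matrix_matrix_mult_def vec_eq_iff)
  moreover have "(\<lambda>\<omega>. x \<omega> - F *v z \<omega>) = e"
    by (simp add: e_def fun_eq_iff matrix_vector_mult_def vec_eq_iff sum_negf)
  ultimately show ?thesis
    by (simp add: lmmse_error_def Let_def F_def[symmetric] ex)
qed

text \<open>For \<open>z = H x + n\<close> with white noise of variance \<open>s\<close>, the normal equation
  \<open>F (H R H\<^sup>T + s I) = R H\<^sup>T\<close> reads \<open>s F = X H\<^sup>T\<close> for the error matrix \<open>X = R - F H R\<close>.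
  Eliminating \<open>F\<close> gives \<open>X (I + H\<^sup>T H R / s) = R\<close>, that is, \<open>X\<close> is the inverse of
  \<open>R\<^sup>-\<^sup>1 + H\<^sup>T H / s\<close>; this replaces the matrix inversion lemma.\<close>

lemma linear_model_lmmse_error:
  fixes x :: "'w \<Rightarrow> real ^ 'm" and n :: "'w \<Rightarrow> real ^ 'k" and H :: "real ^ 'm ^ 'k"
  assumes x: "square_integrable_rv M x" and n: "square_integrable_rv M n"
    and nx: "corr_matrix M n x = 0" and nn: "corr_matrix M n n = s *\<^sub>R mat 1" and s: "0 < s"
    and psd: "\<And>u. 0 \<le> u \<bullet> (corr_matrix M x x *v u)"
    and Ri: "corr_matrix M x x ** Ri = mat 1"
  obtains X where "lmmse_error M x (\<lambda>\<omega>. H *v x \<omega> + n \<omega>) = trace X"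
    "(Ri + (1 / s) *\<^sub>R (transpose H ** H)) ** X = mat 1"
proof -
  define R where "R = corr_matrix M x x"
  define z where "z = (\<lambda>\<omega>. H *v x \<omega> + n \<omega>)"
  define F where "F = lmmse_matrix M x z"
  have Hx: "square_integrable_rv M (\<lambda>\<omega>. H *v x \<omega>)"
    by (rule square_integrable_rv_matrix[OF x])
  have z: "square_integrable_rv M z"
    unfolding z_def by (rule square_integrable_rv_add[OF Hx n])
  have xn: "corr_matrix M x n = 0"
    using nx corr_matrix_transpose[of M x n] by (simp add: transpose_def vec_eq_iff)
  have zx: "corr_matrix M z x = H ** R"
    unfolding z_def corr_matrix_add_left[OF Hx n x] corr_matrix_mult_left[OF x x] nx R_def by simp
  have xz: "corr_matrix M x z = R ** transpose H"
    unfolding z_def corr_matrix_add_right[OF x Hx n] corr_matrix_mult_right[OF x x] xn R_def by simp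
  have nz: "corr_matrix M n z = s *\<^sub>R mat 1"
    unfolding z_def corr_matrix_add_right[OF n Hx n] corr_matrix_mult_right[OF n x] nx nn
    by (simp add: matrix_matrix_mult_def vec_eq_iff)
  have zz: "corr_matrix M z z = H ** R ** transpose H + s *\<^sub>R mat 1"
    using corr_matrix_add_left[OF Hx n z] unfolding corr_matrix_mult_left[OF x z] xz nz
    by (simp add: z_def[symmetric] matrix_mul_assoc)
  have "invertible (corr_matrix M z z)"
    unfolding invertible_left_inverse matrix_left_invertible_ker
  proof (intro allI impI)
    fix u assume "corr_matrix M z z *v u = 0"
    moreover have "corr_matrix M z z *v u = H *v (R *v (transpose H *v u)) + s *\<^sub>R u"
      unfolding zz
      by (simp add: matrix_vector_mult_add_rdistrib matrix_vector_mul_assoc matrix_mul_assoc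
          scaleR_matrix_vector_assoc[symmetric] del: transpose_matrix_vector)
    ultimately have "0 = u \<bullet> (H *v (R *v (transpose H *v u)) + s *\<^sub>R u)"
      by simp
    also have "\<dots> = (transpose H *v u) \<bullet> (R *v (transpose H *v u)) + s * (u \<bullet> u)"
      by (simp add: inner_add_right dot_lmul_matrix)
    finally have "s * (u \<bullet> u) \<le> 0"
      using psd[of "transpose H *v u"] by (simp add: R_def)
    then have "u \<bullet> u \<le> 0"
      using s by (simp add: mult_le_0_iff)
    then show "u = 0"
      by (metis inner_gt_zero_iff not_le)
  qed
  then have "matrix_inv (corr_matrix M z z) ** corr_matrix M z z = mat 1"
    unfolding invertible_def matrix_inv_def by (rule someI2_ex) simp
  then have normal: "F ** corr_matrix M z z = corr_matrix M x z"
    unfolding F_def lmmse_matrix_def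
    by (simp add: matrix_mul_assoc[symmetric])
  define X where "X = R - F ** H ** R"
  have "F ** H ** R ** transpose H + s *\<^sub>R F = R ** transpose H"
    using normal unfolding zz xz
    by (simp add: matrix_add_ldistrib matrix_mul_assoc matrix_scalar_ac scalar_matrix_assoc[symmetric])
  then have sF: "s *\<^sub>R F = X ** transpose H"
    by (simp add: X_def matrix_diff_rdistrib algebra_simps)
  then have "F ** H ** R = (1 / s) *\<^sub>R (X ** transpose H ** H ** R)"
    using s by (simp add: sF[symmetric] scalar_matrix_assoc[symmetric])
  then have "R = X + (1 / s) *\<^sub>R (X ** transpose H ** H ** R)"
    by (simp add: X_def)
  then have "R ** Ri = (X + (1 / s) *\<^sub>R (X ** transpose H ** H ** R)) ** Ri"
    by (rule arg_cong[where f = "\<lambda>C. C ** Ri"])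
  also have "\<dots> = X ** Ri + (1 / s) *\<^sub>R (X ** transpose H ** H ** (R ** Ri))"
    by (simp only: matrix_add_rdistrib scalar_matrix_assoc[symmetric] matrix_mul_assoc)
  finally have "mat 1 = X ** Ri + (1 / s) *\<^sub>R (X ** transpose H ** H)"
    unfolding Ri[folded R_def] by simp
  then have "X ** (Ri + (1 / s) *\<^sub>R (transpose H ** H)) = mat 1"
    by (simp add: matrix_add_ldistrib matrix_scalar_ac scalar_matrix_assoc[symmetric] matrix_mul_assoc)
  then have "(Ri + (1 / s) *\<^sub>R (transpose H ** H)) ** X = mat 1"
    by (simp add: matrix_left_right_inverse)
  moreover have "lmmse_error M x z = trace X"
    using lmmse_error_eq_trace[OF x z normal[unfolded F_def]]
    by (simp add: X_def zx F_def[symmetric] R_def[symmetric] matrix_mul_assoc)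
  ultimately show thesis
    using that by (simp add: z_def)
qed

section \<open>Stacked fusion frame measurements\<close>

definition stack_rows :: "('n::finite \<Rightarrow> real ^ 'm ^ 'm) \<Rightarrow> real ^ 'm ^ ('n \<times> 'm)" where
  "stack_rows P = (\<chi> k. P (fst k) $ snd k)"

lemma stack_measurement:
  "stack (\<lambda>i. P i *v x + y i) = stack_rows P *v x + stack y"
  by (simp add: stack_def stack_rows_def vec_eq_iff matrix_vector_mult_def)

lemma stack_rows_gram:
  fixes P :: "'n::finite \<Rightarrow> real ^ 'm ^ 'm"
  shows "transpose (stack_rows P) ** stack_rows P = (\<Sum>i\<in>UNIV. transpose (P i) ** P i)"
proof -
  have "(\<Sum>k\<in>UNIV. f (fst k) (snd k)) = (\<Sum>i\<in>UNIV. \<Sum>j\<in>UNIV. f i j)" for f :: "'n \<Rightarrow> 'm \<Rightarrow> real"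
    unfolding sum.cartesian_product by (simp add: case_prod_beta)
  from this[of "\<lambda>i j. P i $ j $ a * P i $ j $ b" for a b] show ?thesis
    by (simp add: stack_rows_def matrix_matrix_mult_def transpose_def vec_eq_iff)
qed

lemma corr_matrix_stack_eq_0:
  assumes "\<And>i. corr_matrix M (u i) v = 0"
  shows "corr_matrix M (\<lambda>\<omega>. stack (\<lambda>i. u i \<omega>)) v = 0"
  using assms by (simp add: corr_matrix_def stack_def vec_eq_iff)

lemma corr_matrix_stack_white:
  assumes "\<And>i j. i \<noteq> j \<Longrightarrow> corr_matrix M (u i) (u j) = 0"
    and "\<And>i. corr_matrix M (u i) (u i) = c *\<^sub>R mat 1"
  shows "corr_matrix M (\<lambda>\<omega>. stack (\<lambda>i. u i \<omega>)) (\<lambda>\<omega>. stack (\<lambda>i. u i \<omega>)) = c *\<^sub>R mat 1"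
proof -
  have "corr_matrix M (u i) (u j) $ a $ b = (if (i, a) = (j, b) then c else 0)" for i j a b
    using assms(1)[of i j] assms(2)[of i] by (cases "i = j") (auto simp: mat_def)
  then show ?thesis
    by (simp add: corr_matrix_def stack_def vec_eq_iff mat_def)
qed

section \<open>The error bounds\<close>

lemma eigenbasis_quadratic_form:
  fixes v :: "'m::finite \<Rightarrow> real ^ 'm"
  assumes on: "\<And>i j. v i \<bullet> v j = (if i = j then 1 else 0)"
    and sym: "transpose R = R" and eig: "\<And>k. R *v v k = \<mu> k *\<^sub>R v k"
  shows "w \<bullet> (R *v w) = (\<Sum>k\<in>UNIV. \<mu> k * (w \<bullet> v k)\<^sup>2)"
proof -
  have "v k \<bullet> (R *v w) = \<mu> k * (w \<bullet> v k)" for k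
  proof -
    have "v k \<bullet> (R *v w) = (R *v v k) \<bullet> w"
      by (metis sym dot_lmul_matrix transpose_matrix_vector)
    then show ?thesis
      by (simp add: eig inner_commute)
  qed
  then show ?thesis
    by (simp add: orthonormal_family_parseval[of v w "R *v w", OF on] power2_eq_square mult_ac)
qed

theorem mainTheorem1:
  fixes W :: "'n::finite \<Rightarrow> (real ^ 'm) set"
    and P :: "'n \<Rightarrow> real ^ 'm ^ 'm"
    and m :: "'n \<Rightarrow> nat"
    and A B \<sigma> MSE :: real
    and \<Omega> :: "'w measure"
    and x :: "'w \<Rightarrow> real ^ 'm"
    and noise z :: "'n \<Rightarrow> 'w \<Rightarrow> real ^ 'm"
    and l :: "nat \<Rightarrow> real"
  assumes frame: "fusion_frame A B W"
    and dims: "\<And>i. dim (W i) = m i"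
    and P: "\<And>i. P i = proj_matrix (W i)"
    and prob: "prob_space \<Omega>"
    and x_L2: "square_integrable_rv \<Omega> x"
    and x_mean: "integral\<^sup>L \<Omega> x = 0"
    and x_cov: "invertible (corr_matrix \<Omega> x x)"
    and eigs: "sorted_eigenvalues (corr_matrix \<Omega> x x) l"
    and eigs_pos: "0 < l 1"
    and noise_L2: "\<And>i. square_integrable_rv \<Omega> (noise i)"
    and noise_uncorr: "\<And>i j. i \<noteq> j \<Longrightarrow> uncorrelated \<Omega> (noise i) (noise j)"
    and noise_x: "\<And>i. uncorrelated \<Omega> (noise i) x"
    and sigma: "\<sigma>\<^sup>2 > 0"
    and noise_white: "\<And>i. corr_matrix \<Omega> (noise i) (noise i) = \<sigma>\<^sup>2 *\<^sub>R mat 1"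
    and z: "\<And>i \<omega>. z i \<omega> = P i *v x \<omega> + noise i \<omega>"
    and MSE: "MSE = lmmse_error \<Omega> x (\<lambda>\<omega>. stack (\<lambda>i. z i \<omega>))"
  shows "(\<Sum>i=1..CARD('m). 1 / (1 / l i + B / \<sigma>\<^sup>2)) \<le> MSE
    \<and> MSE \<le> (\<Sum>i=1..CARD('m). 1 / (1 / l i + A / \<sigma>\<^sup>2))
    \<and> (A = B \<and> (\<Sum>i\<in>UNIV. P i) = A *\<^sub>R mat 1 \<longrightarrow>
         MSE = (\<Sum>i=1..CARD('m). 1 / (1 / l i + B / \<sigma>\<^sup>2))
       \<and> A = 1 / real CARD('m) * (\<Sum>i\<in>UNIV. real (m i))
       \<and> MSE = (\<Sum>i=1..CARD('m).
            \<sigma>\<^sup>2 * l i / (\<sigma>\<^sup>2 + l i / real CARD('m) * (\<Sum>j\<in>UNIV. real (m j)))))"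
proof -
  define R where "R = corr_matrix \<Omega> x x"
  define S where "S = (\<Sum>i\<in>UNIV. P i)"
  define s where "s = \<sigma>\<^sup>2"
  have s: "0 < s"
    using sigma by (simp add: s_def)
  have AB: "0 < A" "A \<le> B" and sub: "\<And>i. subspace (W i)"
    using frame by (auto simp: fusion_frame_def)
  have form: "w \<bullet> ((C *\<^sub>R mat 1) *v w) = C * (w \<bullet> w)" for C and w :: "real ^ 'm"
    by (simp add: scaleR_matrix_vector_assoc[symmetric])
  have SA: "A * (w \<bullet> w) \<le> w \<bullet> (S *v w)" and SB: "w \<bullet> (S *v w) \<le> B * (w \<bullet> w)" for w
    using frame
    by (auto simp: fusion_frame_def loewner_le_def pos_semidef_def S_def P
        matrix_vector_mult_diff_rdistrib inner_diff_right form)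

  have RT: "transpose R = R"
    unfolding R_def by (rule corr_matrix_transpose[symmetric])
  obtain v :: "'m \<Rightarrow> real ^ 'm" and \<mu> where on: "\<And>i j. v i \<bullet> v j = (if i = j then 1 else 0)"
    and eig: "\<And>k. R *v v k = \<mu> k *\<^sub>R v k"
    using symmetric_matrix_eigenbasis[OF RT] by blast
  have factors: "(\<Prod>k\<in>UNIV. [:- \<mu> k, 1:]) = (\<Prod>i=1..CARD('m). [:- l i, 1:])"
    using eigs charpoly_eigenbasis[of v, OF on RT eig] by (simp add: sorted_eigenvalues_def R_def)
  have l_pos: "0 < l i" if "i \<in> {1..CARD('m)}" for i
  proof -
    have "l 1 \<le> l i"
      using eigs that by (auto simp: sorted_eigenvalues_def intro: mono_onD)
    then show ?thesis
      using eigs_pos by simp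
  qed
  have \<mu>_pos: "0 < \<mu> k" for k
  proof -
    have "poly (\<Prod>k\<in>UNIV. [:- \<mu> k, 1:]) (\<mu> k) = 0"
      by (auto simp: poly_prod prod_zero_iff)
    then have "\<exists>i\<in>{1..CARD('m)}. \<mu> k = l i"
      unfolding factors by (auto simp: poly_prod prod_zero_iff)
    then show ?thesis
      using l_pos by auto
  qed

  obtain Ri where Ri: "R ** Ri = mat 1" "Ri ** R = mat 1"
    using x_cov by (auto simp: R_def invertible_def)
  have RiT: "transpose Ri = Ri"
    by (metis RT Ri matrix_mul_assoc matrix_mul_lid matrix_mul_rid matrix_transpose_mul transpose_mat)
  have Ri_eig: "Ri *v v k = (1 / \<mu> k) *\<^sub>R v k" for k
  proof -
    have "v k = Ri *v (R *v v k)"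
      by (simp add: matrix_vector_mul_assoc Ri)
    then have "v k = \<mu> k *\<^sub>R (Ri *v v k)"
      by (simp add: eig matrix_vector_mult_scaleR)
    then have "(1 / \<mu> k) *\<^sub>R v k = (1 / \<mu> k) *\<^sub>R (\<mu> k *\<^sub>R (Ri *v v k))"
      by simp
    then show ?thesis
      using \<mu>_pos[of k] by simp
  qed

  define n where "n = (\<lambda>\<omega>. stack (\<lambda>i. noise i \<omega>))"
  have z_stack: "(\<lambda>\<omega>. stack (\<lambda>i. z i \<omega>)) = (\<lambda>\<omega>. stack_rows P *v x \<omega> + n \<omega>)"
    by (simp add: z stack_measurement n_def)
  have gram: "transpose (stack_rows P) ** stack_rows P = S"
    by (simp add: stack_rows_gram P S_def transpose_proj_matrix[OF sub] proj_matrix_idem[OF sub])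
  have "square_integrable_rv \<Omega> n"
    unfolding n_def by (rule square_integrable_rv_stack[OF noise_L2])
  moreover have "corr_matrix \<Omega> n x = 0"
    unfolding n_def using noise_x by (intro corr_matrix_stack_eq_0) (simp add: uncorrelated_def)
  moreover have "corr_matrix \<Omega> n n = s *\<^sub>R mat 1"
    unfolding n_def s_def using noise_uncorr noise_white
    by (intro corr_matrix_stack_white) (simp_all add: uncorrelated_def)
  moreover have "0 \<le> u \<bullet> (corr_matrix \<Omega> x x *v u)" for u
    unfolding R_def[symmetric] eigenbasis_quadratic_form[of v, OF on RT eig]
    by (intro sum_nonneg mult_nonneg_nonneg less_imp_le[OF \<mu>_pos]) simp
  ultimately obtain X where MSE_X: "MSE = trace X" and inv: "(Ri + (1 / s) *\<^sub>R S) ** X = mat 1"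
    using linear_model_lmmse_error[OF x_L2 _ _ _ s _ Ri(1)[unfolded R_def], of n "stack_rows P"]
    unfolding MSE z_stack gram by blast

  define Y where "Y = Ri + (1 / s) *\<^sub>R S"
  have Y_form: "w \<bullet> (Y *v w) = (\<Sum>k\<in>UNIV. 1 / \<mu> k * (w \<bullet> v k)\<^sup>2) + (w \<bullet> (S *v w)) / s" for w
    unfolding eigenbasis_quadratic_form[of v, OF on RiT Ri_eig, symmetric] Y_def
    by (simp add: matrix_vector_mult_add_rdistrib scaleR_matrix_vector_assoc[symmetric] inner_add_right)
  have C_form: "(\<Sum>k\<in>UNIV. (1 / \<mu> k + C / s) * (w \<bullet> v k)\<^sup>2)
      = (\<Sum>k\<in>UNIV. 1 / \<mu> k * (w \<bullet> v k)\<^sup>2) + C * (w \<bullet> w) / s" for C w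
    by (simp add: orthonormal_family_parseval[of v w w, OF on] distrib_right sum.distrib
        sum_distrib_left sum_divide_distrib power2_eq_square inner_commute)
  have YA: "(\<Sum>k\<in>UNIV. (1 / \<mu> k + A / s) * (w \<bullet> v k)\<^sup>2) \<le> w \<bullet> (Y *v w)" for w
    unfolding Y_form C_form using SA[of w] s by (simp add: divide_right_mono)
  have YB: "w \<bullet> (Y *v w) \<le> (\<Sum>k\<in>UNIV. (1 / \<mu> k + B / s) * (w \<bullet> v k)\<^sup>2)" for w
    unfolding Y_form C_form using SB[of w] s by (simp add: divide_right_mono)
  have pos: "0 < 1 / \<mu> k + C / s" if "0 < C" for C k
    using \<mu>_pos[of k] s that by (intro add_pos_pos divide_pos_pos) auto
  have psd: "pos_semidef Y"
    unfolding pos_semidef_def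
  proof
    have "transpose S = S"
      unfolding gram[symmetric] by (simp add: matrix_transpose_mul)
    then show "transpose Y = Y"
      using RiT by (simp add: Y_def transpose_def vec_eq_iff)
    show "\<forall>w. 0 \<le> w \<bullet> (Y *v w)"
      by (intro allI order.trans[OF _ YA] sum_nonneg mult_nonneg_nonneg less_imp_le[OF pos[OF AB(1)]]) simp
  qed

  have sum_l: "(\<Sum>k\<in>UNIV. 1 / (1 / \<mu> k + C / s)) = (\<Sum>i=1..CARD('m). 1 / (1 / l i + C / s))" for C
    by (rule sum_linear_factors_cong[OF factors, of "\<lambda>t. 1 / (1 / t + C / s)"])
  have upper: "MSE \<le> (\<Sum>i=1..CARD('m). 1 / (1 / l i + A / s))"
    unfolding MSE_X sum_l[symmetric]
    by (rule trace_inverse_le[of v Y, OF on inv[folded Y_def] pos[OF AB(1)] YA])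
  have "0 < B"
    using AB by simp
  then have lower: "(\<Sum>i=1..CARD('m). 1 / (1 / l i + B / s)) \<le> MSE"
    unfolding MSE_X sum_l[symmetric]
    by (intro trace_inverse_ge[of v Y, OF on inv[folded Y_def] pos psd YB])

  have tight: "MSE = (\<Sum>i=1..CARD('m). 1 / (1 / l i + B / s))
       \<and> A = 1 / real CARD('m) * (\<Sum>i\<in>UNIV. real (m i))
       \<and> MSE = (\<Sum>i=1..CARD('m). s * l i / (s + l i / real CARD('m) * (\<Sum>j\<in>UNIV. real (m j))))"
    if "A = B" and S_tight: "(\<Sum>i\<in>UNIV. P i) = A *\<^sub>R mat 1"
  proof -
    have MSE_eq: "MSE = (\<Sum>i=1..CARD('m). 1 / (1 / l i + A / s))"
      using upper lower \<open>A = B\<close> by simp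
    have "(\<Sum>i\<in>UNIV. real (m i)) = trace S"
      unfolding S_def P trace_def sum_component
      by (subst sum.swap) (simp add: trace_def[symmetric] trace_proj_matrix[OF sub] dims)
    also have "\<dots> = real CARD('m) * A"
      unfolding S_def S_tight by (simp add: trace_def mat_def)
    finally have sum_m: "(\<Sum>i\<in>UNIV. real (m i)) = real CARD('m) * A" .
    have "1 / (1 / l i + A / s) = s * l i / (s + l i / real CARD('m) * (\<Sum>j\<in>UNIV. real (m j)))"
      if "i \<in> {1..CARD('m)}" for i
      unfolding sum_m using l_pos[OF that] s AB(1) by (simp add: divide_simps) (simp add: algebra_simps)
    then have "MSE = (\<Sum>i=1..CARD('m). s * l i / (s + l i / real CARD('m) * (\<Sum>j\<in>UNIV. real (m j))))"
      unfolding MSE_eq by (rule sum.cong[OF refl])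
    then show ?thesis
      using MSE_eq \<open>A = B\<close> sum_m by simp
  qed
  show ?thesis
    using lower upper tight unfolding s_def by blast
qed

end
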